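(* Let $\mathscr{S} \ni s \mapsto T_s \in \mathscr{L}(H)$ be a homomorphism of a weakly right amenable SGT $\mathscr{S}$ into $\mathscr{L}(H)$ (where $H$ is a Hilbert space) that is continuous in the strong operator topology of $\mathscr{L}(H)$. Further, suppose there exist an operator $A_0 \in \mathscr{L}(H)$ and two functions $m, M : H \to (0,\infty)$ such that for any $x \in H$, $$m(x) \|x\| \leqslant \|A_0 T_s x\| \leqslant M(x) \|x\| \qquad (s \in \mathscr{S}).$$ Then there exist a positive operator $A \in \mathscr{L}(H)$ with trivial kernel and a homomorphism $\mathscr{S} \ni s \mapsto V_s \in \mathscr{L}(H)$ continuous in the strong operator topology such that: (1) $m(x) \|x\| \leqslant \|A x\| \leqslant M(x) \|x\|$ for any $x \in H$; (2) $A T_s = V_s A$ for all $s \in \mathscr{S}$; (3) $V_s$ is an isometry for any $s \in \mathscr{S}$.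
   Context: An SGT (semigroup with topology) is a non-empty semigroup $\mathscr{S}$ that is also a (possibly non-Hausdorff) topological space; no compatibility between the multiplication and the topology is assumed. For $f:\mathscr{S}\to\mathbb{R}$ and $s\in\mathscr{S}$ let $f_s(t)=f(ts)$. $C_b(\mathscr{S})$ is the space of bounded continuous real-valued functions on $\mathscr{S}$ with the sup-norm, and $C_r(\mathscr{S})=\{f\in C_b(\mathscr{S}): f_s \text{ is continuous for every } s\in\mathscr{S}\}$. Let $C_{norm}(\mathscr{S})$ be the set of all $f\in C_r(\mathscr{S})$ such that $s\mapsto f_s$ and, for all $t\in\mathscr{S}$, $s\mapsto f_{st}$ are continuous from $\mathscr{S}$ to $C_r(\mathscr{S})$ with the norm topology. $\mathscr{S}$ is weakly right amenable if there is a right invariant mean on $C_{norm}(\mathscr{S})$, i.e. a linear functional $\phi:C_{norm}(\mathscr{S})\to\mathbb{R}$ with $\inf f(\mathscr{S})\leqslant\phi(f)\leqslant\sup f(\mathscr{S})$ and $\phi(f_s)=\phi(f)$ for all $f\in C_{norm}(\mathscr{S})$, $s\in\mathscr{S}$. Hilbert spaces are real or complex. $\mathscr{L}(H)$ is the algebra of bounded linear operators on $H$; $s\mapsto T_s$ is a homomorphism if $T_{st}=T_sT_t$ for all $s,t$. Positive operators are self-adjoint operators $A$ with $\langle Ax,x\rangle\geqslant 0$ for all $x$. An isometry need not be surjective. *)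

theory Defs
  imports "HOL-Analysis.Analysis"
begin

subsection \<open>Means on semigroups with topology\<close>

text \<open>
  A semigroup with topology is a type of sort \<open>{semigroup_mult, topological_space}\<close>: no
  separation axiom, and no axiom linking the multiplication to the topology.
\<close>

text \<open>
  The translate \<open>f\<^sub>s(t) = f(ts)\<close>, as an element of the space of bounded continuous functions.
  It is always bounded, but \<open>Bcontfun\<close> yields a meaningful value only if \<open>f\<^sub>s\<close> is continuous;
  it is used only for \<open>f\<close> in \<open>C_r\<close>, where this holds for every \<open>s\<close>.
\<close>
definition right_translate ::
    "'s::{semigroup_mult,topological_space} \<Rightarrow> ('s \<Rightarrow>\<^sub>C real) \<Rightarrow> ('s \<Rightarrow>\<^sub>C real)" where
  "right_translate s f = Bcontfun (\<lambda>t. apply_bcontfun f (t * s))"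

definition C_r :: "('s::{semigroup_mult,topological_space} \<Rightarrow>\<^sub>C real) set" where
  "C_r = {f. \<forall>s. continuous_on UNIV (\<lambda>t. apply_bcontfun f (t * s))}"

definition C_norm :: "('s::{semigroup_mult,topological_space} \<Rightarrow>\<^sub>C real) set" where
  "C_norm = {f \<in> C_r. continuous_on UNIV (\<lambda>s. right_translate s f) \<and>
                      (\<forall>t. continuous_on UNIV (\<lambda>s. right_translate (s * t) f))}"

lemma apply_right_translate:
  assumes "f \<in> C_r"
  shows "apply_bcontfun (right_translate s f) t = apply_bcontfun f (t * s)"
proof -
  have "bounded (range (\<lambda>t. apply_bcontfun f (t * s)))"
    by (rule bounded_subset[OF bounded_apply_bcontfun[of f]]) auto
  then have "(\<lambda>t. apply_bcontfun f (t * s)) \<in> bcontfun"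
    using assms by (simp add: C_r_def bcontfun_def)
  then show ?thesis
    by (simp add: right_translate_def Bcontfun_inverse)
qed

text \<open>
  A functional on the subspace \<open>C_norm\<close> is represented by a function on all of \<open>'s \<Rightarrow>\<^sub>C real\<close>
  whose values outside \<open>C_norm\<close> are irrelevant.
\<close>
definition right_invariant_mean ::
    "(('s::{semigroup_mult,topological_space} \<Rightarrow>\<^sub>C real) \<Rightarrow> real) \<Rightarrow> bool" where
  "right_invariant_mean \<phi> \<longleftrightarrow>
     (\<forall>f\<in>C_norm. \<forall>g\<in>C_norm. \<phi> (f + g) = \<phi> f + \<phi> g) \<and>
     (\<forall>f\<in>C_norm. \<forall>c. \<phi> (c *\<^sub>R f) = c * \<phi> f) \<and>
     (\<forall>f\<in>C_norm. Inf (range (apply_bcontfun f)) \<le> \<phi> f \<and> \<phi> f \<le> Sup (range (apply_bcontfun f))) \<and>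
     (\<forall>f\<in>C_norm. \<forall>s. \<phi> (right_translate s f) = \<phi> f)"

definition weakly_right_amenable ::
    "'s::{semigroup_mult,topological_space} itself \<Rightarrow> bool" where
  "weakly_right_amenable S \<longleftrightarrow> (\<exists>\<phi> :: ('s \<Rightarrow>\<^sub>C real) \<Rightarrow> real. right_invariant_mean \<phi>)"


subsection \<open>Real and complex Hilbert spaces\<close>

text \<open>
  The class of scalar fields covers the reals (with trivial conjugation) and the complex numbers
  (with the usual one) simultaneously; up to isomorphism it has no other instances, see
  \<open>real_or_complex\<close> below.
\<close>
class real_or_complex_field = real_normed_field +
  fixes conjg :: "'a \<Rightarrow> 'a"
  assumes conjg_add: "conjg (x + y) = conjg x + conjg y"
    and conjg_mult: "conjg (x * y) = conjg x * conjg y"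
    and conjg_conjg: "conjg (conjg x) = x"
    and conjg_scaleR: "conjg (r *\<^sub>R x) = r *\<^sub>R conjg x"
    and mult_conjg_scaleR: "x * conjg x = (norm x)\<^sup>2 *\<^sub>R 1"

lemma mult_conjg: "x * conjg x = of_real ((norm x)\<^sup>2)" for x :: "'k::real_or_complex_field"
  unfolding of_real_def by (rule mult_conjg_scaleR)

lemma conjg_of_real: "conjg (of_real r) = (of_real r :: 'k::real_or_complex_field)"
proof -
  have "conjg (1::'k) = 1" using mult_conjg[of "1::'k"] by simp
  then show ?thesis by (simp add: of_real_def conjg_scaleR)
qed

instantiation real :: real_or_complex_field
begin
definition conjg_real :: "real \<Rightarrow> real" where "conjg_real x = x"
instance by standard (simp_all add: conjg_real_def power2_eq_square)
end

instantiation complex :: real_or_complex_field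
begin
definition conjg_complex :: "complex \<Rightarrow> complex" where "conjg_complex = cnj"
instance by standard (simp_all add: conjg_complex_def complex_norm_square scaleR_conv_of_real del: of_real_power)
end

lemma real_or_complex:
  "(\<forall>z::'k::real_or_complex_field. z \<in> \<real> \<and> conjg z = z) \<or>
         (\<exists>i::'k. i * i = - 1 \<and>
            (\<forall>z. \<exists>!(a, b). z = of_real a + of_real b * i) \<and>
            (\<forall>a b. conjg (of_real a + of_real b * i) = of_real a - of_real b * i))"
proof (cases "\<forall>z::'k. z \<in> \<real>")
  case True
  then show ?thesis
    by (metis Reals_cases conjg_of_real)
next
  case False
  have real_trace: "\<exists>a. z + conjg z = of_real a" for z :: 'k
  proof -
    have "conjg (1::'k) = 1" using conjg_of_real[of 1] by simp
    then have "(1 + z) * conjg (1 + z) = 1 + (z + conjg z) + z * conjg z"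
      by (simp add: conjg_add algebra_simps)
    then have "z + conjg z = of_real ((norm (1 + z))\<^sup>2 - 1 - (norm z)\<^sup>2)"
      unfolding mult_conjg by (simp add: algebra_simps)
    then show ?thesis by blast
  qed
  have conjg_minus: "conjg (- z) = - conjg z" for z :: 'k
    using conjg_mult[of "of_real (-1)" z] conjg_of_real[of "-1", where ?'k='k] by simp
  have split: "\<exists>a w. z = of_real a + w \<and> conjg w = - w \<and> w * w = - of_real ((norm w)\<^sup>2)"
    for z :: 'k
  proof -
    obtain a where a: "z + conjg z = of_real a" using real_trace by blast
    define w where "w = z - of_real (a/2)"
    have "conjg w = conjg z - of_real (a/2)"
      using conjg_add[of z "- of_real (a/2)"]
      by (simp only: w_def diff_conv_add_uminus conjg_minus conjg_of_real)
    also have "\<dots> = - w"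
    proof -
      have "conjg z = of_real (a/2 + a/2) - z" using a by (simp add: algebra_simps)
      then show ?thesis unfolding of_real_add w_def by (simp add: algebra_simps del: of_real_divide)
    qed
    finally have c: "conjg w = - w" .
    have "w * w = - of_real ((norm w)\<^sup>2)"
      using mult_conjg[of w] unfolding c by (metis minus_minus mult_minus_right)
    then show ?thesis using c by (intro exI[of _ "a/2"] exI[of _ w]) (simp add: w_def)
  qed
  obtain z0 :: 'k where z0: "z0 \<notin> \<real>" using False by blast
  obtain a0 w0 where w0: "z0 = of_real a0 + w0" "conjg w0 = - w0"
      "w0 * w0 = - of_real ((norm w0)\<^sup>2)"
    using split by blast
  have "w0 \<noteq> 0" using z0 w0(1) by auto
  define i where "i = of_real (1 / norm w0) * w0"
  have ii: "i * i = - 1"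
  proof -
    have "i * i = of_real ((1 / norm w0)\<^sup>2) * (w0 * w0)"
      by (simp add: i_def power2_eq_square)
    also have "\<dots> = - of_real ((1 / norm w0)\<^sup>2 * (norm w0)\<^sup>2)"
      unfolding w0(3) by simp
    finally show ?thesis using \<open>w0 \<noteq> 0\<close> by (simp add: power_divide)
  qed
  have ci: "conjg i = - i" by (simp add: i_def conjg_mult conjg_of_real w0(2) del: of_real_divide)
  have i_nonreal: "i \<noteq> of_real r" for r
  proof
    assume "i = of_real r"
    then have "of_real (r * r) = (of_real (- 1) :: 'k)" using ii by simp
    then have "r * r = - 1" unfolding of_real_eq_iff .
    then show False by (metis neg_0_le_iff_le not_one_le_zero zero_le_square)
  qed
  have ex: "\<exists>a b. z = of_real a + of_real b * i" for z
  proof -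
    obtain a w where w: "z = of_real a + w" "w * w = - of_real ((norm w)\<^sup>2)"
      using split by blast
    have "w * w = (of_real (norm w) * i) * (of_real (norm w) * i)"
    proof -
      have "(of_real (norm w) * i) * (of_real (norm w) * i) = of_real ((norm w)\<^sup>2) * (i * i)"
        by (simp add: power2_eq_square)
      then show ?thesis by (simp add: ii w(2))
    qed
    then have "w = of_real (norm w) * i \<or> w = - (of_real (norm w) * i)"
      by (rule square_eq_iff[THEN iffD1])
    then have "w = of_real (norm w) * i \<or> w = of_real (- norm w) * i" by simp
    then show ?thesis using w(1) by metis
  qed
  have uniq: "a = a' \<and> b = b'"
    if e: "of_real a + of_real b * i = of_real a' + of_real b' * i" for a b a' b'
  proof -
    have d: "of_real (b - b') * i = of_real (a' - a)" using e by (simp add: algebra_simps)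
    have "b = b'"
    proof (rule ccontr)
      assume "b \<noteq> b'"
      then have "i = of_real ((a' - a) / (b - b'))"
        using d by (simp add: nonzero_eq_divide_eq of_real_divide mult.commute)
      then show False using i_nonreal by blast
    qed
    then show ?thesis using d by simp
  qed
  have "\<exists>!(a, b). z = of_real a + of_real b * i" for z
  proof -
    obtain a b where z: "z = of_real a + of_real b * i" using ex by blast
    show ?thesis
      by (rule ex1I[of _ "(a, b)"]) (use uniq z in auto)
  qed
  moreover have "conjg (of_real a + of_real b * i) = of_real a - of_real b * i" for a b
    by (simp add: conjg_add conjg_mult conjg_of_real ci)
  ultimately show ?thesis using ii by blast
qed

text \<open>
  A Hilbert space over \<open>'k\<close>: the scalar multiplication \<open>scal\<close> extends the real one, and the
  inner product \<open>ip\<close> (linear in the first argument) induces the norm of the type, which is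
  complete. By polarization the real inner product of the type is then the real part of \<open>ip\<close>,
  so its presence imposes no restriction.
\<close>
locale hilbert_space = vector_space scal
  for scal :: "'k::real_or_complex_field \<Rightarrow> 'h::{real_inner,complete_space} \<Rightarrow> 'h" +
  fixes ip :: "'h \<Rightarrow> 'h \<Rightarrow> 'k"
  assumes scale_of_real: "scal (of_real r) x = r *\<^sub>R x"
    and ip_add_left: "ip (x + y) z = ip x z + ip y z"
    and ip_scale_left: "ip (scal c x) y = c * ip x y"
    and ip_conjg: "ip y x = conjg (ip x y)"
    and ip_self: "ip x x = of_real ((norm x)\<^sup>2)"

lemma hilbert_space_real:
  "hilbert_space (scaleR :: real \<Rightarrow> 'h::{real_inner,complete_space} \<Rightarrow> 'h) inner"
  by unfold_locales
    (auto simp: conjg_real_def power2_norm_eq_inner scaleR_add_right scaleR_add_left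
      intro: inner_add_left inner_commute)

lemma hilbert_space_complex: "hilbert_space (*) (\<lambda>x y. x * cnj y)"
  by unfold_locales
    (simp_all add: conjg_complex_def algebra_simps scaleR_conv_of_real complex_norm_square
      del: of_real_power)

text \<open>
  The library's bounded linear operators \<open>'h \<Rightarrow>\<^sub>L 'h\<close> are only real-linear, so linearity over
  \<open>'k\<close> is imposed separately.
\<close>
definition bounded_operators ::
    "('k::real_or_complex_field \<Rightarrow> 'h::real_normed_vector \<Rightarrow> 'h) \<Rightarrow> ('h \<Rightarrow>\<^sub>L 'h) set" where
  "bounded_operators scal = {T. \<forall>c x. blinfun_apply T (scal c x) = scal c (blinfun_apply T x)}"

definition positive_operator ::
    "('h::real_normed_vector \<Rightarrow> 'h \<Rightarrow> 'k::real_or_complex_field) \<Rightarrow> ('h \<Rightarrow>\<^sub>L 'h) \<Rightarrow> bool" where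
  "positive_operator ip A \<longleftrightarrow>
     (\<forall>x y. ip (blinfun_apply A x) y = ip x (blinfun_apply A y)) \<and>
     (\<forall>x. \<exists>r\<ge>0. ip (blinfun_apply A x) x = of_real r)"

definition sot_continuous_hom ::
    "('k::real_or_complex_field \<Rightarrow> 'h::real_normed_vector \<Rightarrow> 'h) \<Rightarrow>
     ('s::{semigroup_mult,topological_space} \<Rightarrow> ('h \<Rightarrow>\<^sub>L 'h)) \<Rightarrow> bool" where
  "sot_continuous_hom scal T \<longleftrightarrow>
     (\<forall>s. T s \<in> bounded_operators scal) \<and>
     (\<forall>s t. T (s * t) = T s o\<^sub>L T t) \<and>
     continuous_map euclidean strong_operator_topology T"

end

theory Submission
  imports Defs
begin

text \<open>
  The idea is to average the inner product \<open>\<langle>A\<^sub>0 x, A\<^sub>0 y\<rangle>\<close> over the semigroup. Put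
  \<open>S\<^sub>s = A\<^sub>0 T\<^sub>s\<close>. The upper estimate bounds \<open>\<parallel>S\<^sub>s x\<parallel>\<close> for each fixed \<open>x\<close>, so
  \<open>\<parallel>S\<^sub>s x\<parallel> \<le> C \<parallel>x\<parallel>\<close> with one constant \<open>C\<close> (\<open>uniform_boundedness\<close>). Hence
  \<open>f\<^sub>x\<^sub>y(s) = \<langle>S\<^sub>s x, S\<^sub>s y\<rangle>\<close> is a bounded continuous function that depends on \<open>(x, y)\<close> as a bounded
  bilinear map. Because \<open>T\<close> is a homomorphism, translating \<open>f\<^sub>x\<^sub>y\<close> by \<open>s\<close> gives
  \<open>f\<^sub>u\<^sub>v\<close> with \<open>u = T\<^sub>s x\<close> and \<open>v = T\<^sub>s y\<close>; strong continuity of \<open>T\<close> therefore makes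
  the translates norm continuous in \<open>s\<close> and puts \<open>f\<^sub>x\<^sub>y\<close> into \<open>C_norm\<close>. An invariant mean \<open>\<phi>\<close>
  yields a form \<open>B(x, y) = \<phi>(f\<^sub>x\<^sub>y)\<close> that is invariant under every \<open>T\<^sub>s\<close>, and
  \<open>(m(x) \<parallel>x\<parallel>)\<^sup>2 \<le> B(x, x) \<le> (M(x) \<parallel>x\<parallel>)\<^sup>2\<close> since a mean lies between infimum and
  supremum (\<open>averaged_form\<close>).

  By the Riesz theorem \<open>B(x, y) = \<langle>G x, y\<rangle>\<close> with \<open>G\<close> bounded and positive; let \<open>A\<close> be its
  positive square root (\<open>positive_operator_sqrt\<close>). Then \<open>\<parallel>A x\<parallel>\<^sup>2 = B(x, x)\<close>, which gives the two
  estimates and the trivial kernel. Invariance of \<open>B\<close> reads \<open>\<parallel>A T\<^sub>s x\<parallel> = \<parallel>A x\<parallel>\<close>, so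
  \<open>A x \<mapsto> A T\<^sub>s x\<close> is a well defined linear isometry on the range of \<open>A\<close>. That range is dense, as \<open>A\<close> is
  self-adjoint and injective, so the map extends to an isometry \<open>V\<^sub>s\<close> of the whole space
  (\<open>isometric_extension\<close>). Linearity over the scalar field, \<open>V\<^sub>s\<^sub>t = V\<^sub>s V\<^sub>t\<close> and strong continuity
  hold on the dense range and carry over to the whole space.

  The form \<open>B\<close> is built from the real inner product, so \<open>G\<close> and \<open>A\<close> are at first only real-linear.
  Their linearity over the scalar field is a matter of commutation: \<open>G\<close> commutes with scalar
  multiplication because
  \<open>\<langle>c x, y\<rangle> = \<langle>x, c' y\<rangle>\<close>, with \<open>c'\<close> the conjugate of \<open>c\<close>, and the square root commutes with
  whatever commutes with \<open>G\<close>.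
\<close>

section \<open>Uniform boundedness\<close>

text \<open>
  The sets of points where the whole family is bounded by \<open>n\<close> are closed and cover the space, so
  by Baire's theorem one of them contains a ball; linearity moves the estimate from that ball to
  a ball around the origin.
\<close>
lemma uniform_boundedness:
  fixes S :: "'i \<Rightarrow> 'a::{real_normed_vector,complete_space} \<Rightarrow> 'b::real_normed_vector"
  assumes lin: "\<And>i. bounded_linear (S i)"
    and ptw: "\<And>x. \<exists>b. \<forall>i. norm (S i x) \<le> b"
  shows "\<exists>C\<ge>0. \<forall>i x. norm (S i x) \<le> C * norm x"
proof -
  define L where "L n = {x. \<forall>i. norm (S i x) \<le> real n}" for n
  have "closed (L n)" for n
  proof -
    have "closed (\<Inter>i. {x. norm (S i x) \<le> real n})"
      by (intro closed_INT ballI closed_Collect_le continuous_intros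
          bounded_linear.continuous_on[OF lin])
    then show ?thesis by (simp add: L_def Collect_all_eq)
  qed
  moreover have "\<Union> (range L) = UNIV"
  proof -
    have "\<exists>n. x \<in> L n" for x
    proof -
      obtain b where b: "\<And>i. norm (S i x) \<le> b" using ptw by blast
      obtain n where "b \<le> real n" using real_arch_simple by blast
      then have "x \<in> L n" unfolding L_def using b order_trans by blast
      then show ?thesis by blast
    qed
    then show ?thesis by blast
  qed
  ultimately obtain n where "euclidean interior_of (L n) \<noteq> {}"
    using Met_TC.metric_Baire_category_alt[of "range L"]
    by (auto simp: Met_TC.mcomplete_def convergent_eq_Cauchy[symmetric] Cauchy_convergent_iff convergent_def)
  then obtain a U where "open U" "a \<in> U" "U \<subseteq> L n"
    by (auto simp: interior_of_def)
  then obtain e where e: "e > 0" "ball a e \<subseteq> L n"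
    by (meson openE order_trans)
  have "norm (S i x) \<le> (4 * real n / e) * norm x" for i x
  proof (cases "x = 0")
    case True
    then show ?thesis by (simp add: bounded_linear.linear[OF lin] linear_0)
  next
    case False
    interpret bounded_linear "S i" by (rule lin)
    \<comment> \<open>Half of the radius, so that \<open>a + y\<close> stays inside the open ball.\<close>
    define y where "y = (e / (2 * norm x)) *\<^sub>R x"
    have "norm y = e / 2" using False e by (simp add: y_def)
    then have "a + y \<in> ball a e" "a \<in> ball a e" using e by (auto simp: dist_norm)
    then have "a + y \<in> L n" "a \<in> L n" using e(2) by blast+
    then have "norm (S i (a + y)) \<le> n" "norm (S i a) \<le> n" by (auto simp: L_def)
    then have "norm (S i y) \<le> 2 * real n"
      using norm_triangle_ineq4[of "S i (a + y)" "S i a"] by (simp add: add)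
    then show ?thesis
      using False e by (simp add: y_def scaleR field_simps)
  qed
  moreover have "4 * real n / e \<ge> 0" using e by simp
  ultimately show ?thesis by blast
qed

section \<open>Orthogonal projection and the Riesz representation\<close>

text \<open>
  By the parallelogram law a minimizing sequence for the distance to \<open>W\<close> is Cauchy. Its limit
  is a nearest point, and a nearest point cannot be improved in any direction of \<open>W\<close>.
\<close>
lemma orthogonal_projection:
  fixes W :: "'h::{real_inner,complete_space} set"
  assumes "subspace W" and "closed W"
  shows "\<exists>w\<in>W. \<forall>v\<in>W. inner (y - w) v = 0"
proof -
  define d where "d = (INF w\<in>W. (norm (y - w))\<^sup>2)"
  have bdd: "bdd_below ((\<lambda>w. (norm (y - w))\<^sup>2) ` W)" by (rule bdd_belowI[of _ 0]) auto
  have ne: "W \<noteq> {}" using subspace_0[OF assms(1)] by blast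
  have d: "d \<le> (norm (y - w))\<^sup>2" if "w \<in> W" for w
    unfolding d_def by (rule cINF_lower[OF bdd that])
  have "\<exists>w\<in>W. (norm (y - w))\<^sup>2 < d + inverse (Suc n)" for n
  proof -
    have "d < d + inverse (Suc n)" by simp
    then show ?thesis unfolding d_def cINF_less_iff[OF ne bdd] .
  qed
  then obtain w where w: "\<And>n. w n \<in> W" "\<And>n. (norm (y - w n))\<^sup>2 < d + inverse (Suc n)"
    by metis
  have par: "(norm (w i - w j))\<^sup>2 \<le> 2 * inverse (Suc i) + 2 * inverse (Suc j)" for i j
  proof -
    have "(1/2) *\<^sub>R (w i + w j) \<in> W" using w assms(1) by (simp add: subspace_add subspace_scale)
    note mid = d[OF this]
    have "(norm (w i - w j))\<^sup>2 + 4 * (norm (y - (1/2) *\<^sub>R (w i + w j)))\<^sup>2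
        = 2 * (norm (y - w i))\<^sup>2 + 2 * (norm (y - w j))\<^sup>2"
      unfolding power2_norm_eq_inner
      by (simp add: algebra_simps inner_add_left inner_add_right inner_diff_left inner_diff_right
          inner_commute)
    then show ?thesis using mid w(2)[of i] w(2)[of j] by simp
  qed
  have "Cauchy w"
  proof (rule CauchyI')
    fix e :: real assume "e > 0"
    then obtain k where k: "inverse (real (Suc k)) < e\<^sup>2 / 4"
      using reals_Archimedean[of "e\<^sup>2 / 4"] by (auto simp del: of_nat_Suc)
    have "norm (w i - w j) < e" if "i \<ge> k" "j > i" for i j
    proof -
      have "inverse (real (Suc i)) \<le> inverse (real (Suc k))"
        "inverse (real (Suc j)) \<le> inverse (real (Suc k))"
        using that by (auto intro!: le_imp_inverse_le)
      then have "(norm (w i - w j))\<^sup>2 < e\<^sup>2" using par[of i j] k by linarith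
      then show ?thesis using \<open>e > 0\<close> by (simp add: power_less_imp_less_base)
    qed
    then show "\<exists>M. \<forall>m\<ge>M. \<forall>n>m. dist (w m) (w n) < e" unfolding dist_norm by blast
  qed
  then obtain z where z: "w \<longlonglongrightarrow> z" by (auto simp: Cauchy_convergent_iff convergent_def)
  have zW: "z \<in> W" using closed_sequentially[OF assms(2) w(1) z] .
  have "(\<lambda>n. (norm (y - w n))\<^sup>2) \<longlonglongrightarrow> (norm (y - z))\<^sup>2" by (intro tendsto_intros z)
  moreover have "(\<lambda>n. d + inverse (real (Suc n))) \<longlonglongrightarrow> d + 0"
    by (intro tendsto_intros LIMSEQ_inverse_real_of_nat)
  ultimately have zd: "(norm (y - z))\<^sup>2 \<le> d"
    using w(2) by (intro LIMSEQ_le[of _ _ _ d]) (auto intro: less_imp_le)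
  have "inner (y - z) v = 0" if v: "v \<in> W" for v
  proof (cases "v = 0")
    case False
    \<comment> \<open>This step length minimizes the distance from \<open>y\<close> along the line through \<open>z\<close> in direction \<open>v\<close>.\<close>
    define t where "t = inner (y - z) v / inner v v"
    have "z + t *\<^sub>R v \<in> W" using zW v assms(1) by (simp add: subspace_add subspace_scale)
    from order_trans[OF zd d[OF this]] have "(norm (y - z))\<^sup>2 \<le> (norm ((y - z) - t *\<^sub>R v))\<^sup>2"
      by (simp only: diff_diff_eq)
    also have "\<dots> = (norm (y - z))\<^sup>2 - 2 * t * inner (y - z) v + t\<^sup>2 * inner v v"
      unfolding power2_norm_eq_inner
      by (simp add: algebra_simps inner_diff_left inner_diff_right inner_commute power2_eq_square)
    also have "\<dots> = (norm (y - z))\<^sup>2 - (inner (y - z) v)\<^sup>2 / inner v v"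
      using False by (simp add: t_def power2_eq_square)
    finally have "(inner (y - z) v)\<^sup>2 / inner v v \<le> 0" by simp
    moreover have "inner v v > 0" using False by simp
    ultimately show ?thesis by (simp add: divide_le_0_iff)
  qed simp
  then show ?thesis using zW by blast
qed

text \<open>
  The kernel of a nonzero \<open>f\<close> has codimension one, so a nonzero vector orthogonal to it represents
  \<open>f\<close> up to a scalar.
\<close>
lemma riesz_representation:
  fixes f :: "'h::{real_inner,complete_space} \<Rightarrow> real"
  assumes "bounded_linear f"
  shows "\<exists>z. \<forall>y. inner z y = f y"
proof (cases "\<forall>y. f y = 0")
  case True
  then show ?thesis by (intro exI[of _ 0]) simp
next
  case False
  interpret bounded_linear f by fact
  obtain u where u: "f u \<noteq> 0" using False by blast
  have "closed {y. f y = 0}"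
    by (intro closed_Collect_eq continuous_intros bounded_linear.continuous_on[OF assms])
  moreover have "subspace {y. f y = 0}" by (simp add: subspace_def add scaleR zero)
  ultimately obtain w where w: "f w = 0" "\<And>v. f v = 0 \<Longrightarrow> inner (u - w) v = 0"
    using orthogonal_projection[of "{y. f y = 0}" u] by auto
  define v where "v = u - w"
  have fv: "f v \<noteq> 0" using u w by (simp add: v_def diff)
  then have "inner v v \<noteq> 0" by (auto simp: zero)
  have "inner ((f v / inner v v) *\<^sub>R v) y = f y" for y
  proof -
    have "f (y - (f y / f v) *\<^sub>R v) = 0" using fv by (simp add: diff scaleR)
    from w(2)[OF this] have "inner v y = (f y / f v) * inner v v"
      by (simp add: v_def[symmetric] inner_diff_right)
    then show ?thesis using fv \<open>inner v v \<noteq> 0\<close> by simp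
  qed
  then show ?thesis by blast
qed

lemma bounded_form_operator:
  fixes B :: "'h::{real_inner,complete_space} \<Rightarrow> 'h \<Rightarrow> real"
  assumes "bounded_bilinear B"
  shows "\<exists>G. bounded_linear G \<and> (\<forall>x y. inner (G x) y = B x y)"
proof -
  interpret bounded_bilinear B by fact
  obtain G where G: "\<And>x y. inner (G x) y = B x y"
    using riesz_representation[OF bounded_linear_right] by metis
  obtain K where "0 \<le> K" and K: "\<And>x y. \<bar>B x y\<bar> \<le> norm x * norm y * K"
    using nonneg_bounded by auto
  have "bounded_linear G"
  proof (rule bounded_linear_intro[where K=K])
    show "G (x + y) = G x + G y" for x y
      by (rule vector_eq_ldot[THEN iffD1]) (simp add: inner_add_right inner_commute[of _ "G _"] G add_left)
    show "G (r *\<^sub>R x) = r *\<^sub>R G x" for r x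
      by (rule vector_eq_ldot[THEN iffD1]) (simp add: inner_commute[of _ "G _"] G scaleR_left)
    show "norm (G x) \<le> norm x * K" for x
    proof (cases "G x = 0")
      case True
      with \<open>0 \<le> K\<close> show ?thesis by simp
    next
      case False
      have "norm (G x) * norm (G x) = \<bar>B x (G x)\<bar>"
        by (simp add: G[symmetric] power2_norm_eq_inner[symmetric] power2_eq_square)
      also have "\<dots> \<le> norm x * K * norm (G x)" using K[of x "G x"] by (simp add: mult_ac)
      finally show ?thesis using False by simp
    qed
  qed
  with G show ?thesis by blast
qed

section \<open>Square roots of positive operators\<close>

text \<open>
  For a contraction \<open>K\<close>, a solution of \<open>Y = (K + Y\<^sup>2) / 2\<close> satisfies \<open>(1 - Y)\<^sup>2 = 1 - K\<close>, so
  \<open>1 - Y\<close> is a square root of \<open>1 - K\<close>. The equation is solved by iteration from \<open>0\<close>. The iterates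
  are polynomials in \<open>K\<close> with nonnegative coefficients, hence the same iteration with the number
  \<open>1\<close> in place of \<open>K\<close> dominates them: it bounds both their norms and their increments.
\<close>
primrec sqrt_majorant :: "nat \<Rightarrow> real" where
  "sqrt_majorant 0 = 0"
| "sqrt_majorant (Suc n) = (1 + (sqrt_majorant n)\<^sup>2) / 2"

text \<open>
  The iteration \<open>Y \<mapsto> (K + Y\<^sup>2) / 2\<close> from \<open>0\<close>, written as functions so that the limit can be taken
  at each vector separately.
\<close>
primrec sqrt_iterate :: "('h \<Rightarrow> 'h) \<Rightarrow> nat \<Rightarrow> 'h::real_vector \<Rightarrow> 'h" where
  "sqrt_iterate K 0 x = 0"
| "sqrt_iterate K (Suc n) x = (1/2) *\<^sub>R (K x + sqrt_iterate K n (sqrt_iterate K n x))"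

lemma sqrt_majorant_bounds: "0 \<le> sqrt_majorant n \<and> sqrt_majorant n \<le> 1"
proof (induction n)
  case (Suc n)
  then have "(sqrt_majorant n)\<^sup>2 \<le> 1" by (simp add: power_le_one)
  then show ?case by simp
qed simp

lemma sqrt_majorant_mono: "incseq sqrt_majorant"
proof (rule incseq_SucI)
  fix n
  have "0 \<le> (1 - sqrt_majorant n)\<^sup>2" by simp
  then show "sqrt_majorant n \<le> sqrt_majorant (Suc n)"
    by (simp add: power2_eq_square algebra_simps)
qed

lemma linear_sqrt_iterate:
  assumes "linear K"
  shows "linear (sqrt_iterate K n)"
proof (induction n)
  case 0
  then show ?case by (intro linearI) simp_all
next
  case (Suc n)
  then show ?case
    by (intro linearI)
      (simp_all add: linear_add[OF assms] linear_scale[OF assms] linear_add linear_scale algebra_simps)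
qed

lemma norm_sqrt_iterate_le:
  assumes "\<And>x. norm (K x) \<le> norm (x::'h::real_normed_vector)"
  shows "norm (sqrt_iterate K n x) \<le> sqrt_majorant n * norm x"
proof (induction n arbitrary: x)
  case (Suc n)
  have "norm (sqrt_iterate K n (sqrt_iterate K n x)) \<le> sqrt_majorant n * (sqrt_majorant n * norm x)"
    using Suc sqrt_majorant_bounds by (meson mult_left_mono order_trans)
  then have "norm (K x + sqrt_iterate K n (sqrt_iterate K n x)) \<le> (1 + (sqrt_majorant n)\<^sup>2) * norm x"
    using assms[of x] by (intro order_trans[OF norm_triangle_ineq]) (simp add: algebra_simps power2_eq_square)
  then show ?case by simp
qed simp

text \<open>
  With \<open>Y\<close> and \<open>Z\<close> consecutive iterates, \<open>Z\<^sup>2 - Y\<^sup>2 = (Z - Y) Z + Y (Z - Y)\<close>. If \<open>p \<le> q\<close> dominate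
  \<open>Y\<close> and \<open>Z\<close>, and \<open>q - p\<close> dominates \<open>Z - Y\<close>, then the right-hand side is dominated by
  \<open>(q - p) q + p (q - p) = q\<^sup>2 - p\<^sup>2\<close>, twice the next increment of the scalar iteration.
\<close>
lemma norm_sqrt_iterate_step_le:
  assumes K: "linear K" "\<And>x. norm (K x) \<le> norm (x::'h::real_normed_vector)"
  shows "norm (sqrt_iterate K (Suc n) x - sqrt_iterate K n x)
       \<le> (sqrt_majorant (Suc n) - sqrt_majorant n) * norm x"
proof (induction n arbitrary: x)
  case 0
  then show ?case using K by simp
next
  case (Suc n)
  let ?Y = "sqrt_iterate K n" and ?Z = "sqrt_iterate K (Suc n)"
  let ?p = "sqrt_majorant n" and ?q = "sqrt_majorant (Suc n)"
  have pq: "0 \<le> ?p" "0 \<le> ?q" "?p \<le> ?q"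
    using sqrt_majorant_bounds incseq_SucD[OF sqrt_majorant_mono] by auto
  have "?Z (?Z x) - ?Y (?Y x) = (?Z (?Z x) - ?Y (?Z x)) + ?Y (?Z x - ?Y x)"
    by (simp only: linear_diff[OF linear_sqrt_iterate[OF K(1)]] diff_add_cancel add_diff_eq)
  also have "norm \<dots> \<le> (?q - ?p) * (?q * norm x) + ?p * ((?q - ?p) * norm x)"
  proof (rule order_trans[OF norm_triangle_ineq add_mono])
    show "norm (?Z (?Z x) - ?Y (?Z x)) \<le> (?q - ?p) * (?q * norm x)"
      by (rule order_trans[OF Suc mult_left_mono[OF norm_sqrt_iterate_le[OF K(2)]]]) (use pq in simp)
    show "norm (?Y (?Z x - ?Y x)) \<le> ?p * ((?q - ?p) * norm x)"
      by (rule order_trans[OF norm_sqrt_iterate_le[OF K(2)] mult_left_mono[OF Suc]]) (use pq in simp)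
  qed
  also have "\<dots> = (?q\<^sup>2 - ?p\<^sup>2) * norm x" by (simp only: power2_eq_square) (simp only: algebra_simps)
  finally have *: "norm (?Z (?Z x) - ?Y (?Y x)) \<le> (?q\<^sup>2 - ?p\<^sup>2) * norm x" .
  have "sqrt_iterate K (Suc (Suc n)) x - ?Z x = (1/2) *\<^sub>R (?Z (?Z x) - ?Y (?Y x))"
    by (simp only: sqrt_iterate.simps scaleR_right_diff_distrib[symmetric] add_diff_cancel_left)
  then have "norm (sqrt_iterate K (Suc (Suc n)) x - ?Z x) = norm (?Z (?Z x) - ?Y (?Y x)) / 2"
    by simp
  also have "\<dots> \<le> (?q\<^sup>2 - ?p\<^sup>2) * norm x / 2" using * by linarith
  also have "\<dots> = (sqrt_majorant (Suc (Suc n)) - ?q) * norm x"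
    by (simp add: field_simps)
  finally show ?case .
qed

lemma norm_sqrt_iterate_diff_le:
  assumes K: "linear K" "\<And>x. norm (K x) \<le> norm (x::'h::real_normed_vector)" and "m \<le> n"
  shows "norm (sqrt_iterate K n x - sqrt_iterate K m x) \<le> (sqrt_majorant n - sqrt_majorant m) * norm x"
  using \<open>m \<le> n\<close>
proof (induction n rule: dec_induct)
  case (step n)
  have "norm (sqrt_iterate K (Suc n) x - sqrt_iterate K m x)
     \<le> norm (sqrt_iterate K (Suc n) x - sqrt_iterate K n x) + norm (sqrt_iterate K n x - sqrt_iterate K m x)"
    by (rule norm_diff_triangle_le[OF order_refl order_refl])
  also have "\<dots> \<le> (sqrt_majorant (Suc n) - sqrt_majorant n) * norm x
      + (sqrt_majorant n - sqrt_majorant m) * norm x"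
    by (intro add_mono norm_sqrt_iterate_step_le[OF K] step.IH)
  finally show ?case by (simp only: algebra_simps)
qed simp

text \<open>
  The increments are dominated by those of a bounded monotone sequence of numbers.
\<close>
lemma convergent_sqrt_iterate:
  assumes K: "linear K" "\<And>x. norm (K x) \<le> norm (x::'h::{real_normed_vector,complete_space})"
  shows "convergent (\<lambda>n. sqrt_iterate K n x)"
proof -
  have "Cauchy (\<lambda>n. sqrt_iterate K n x)"
  proof (rule CauchyI')
    fix e :: real assume e: "e > 0"
    obtain l where "sqrt_majorant \<longlonglongrightarrow> l"
      using incseq_convergent[OF sqrt_majorant_mono, of 1] sqrt_majorant_bounds by blast
    then have "Cauchy sqrt_majorant" by (rule LIMSEQ_imp_Cauchy)
    moreover have "e / (norm x + 1) > 0" using e by (simp add: add_nonneg_pos)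
    ultimately obtain N where N: "\<And>m n. m \<ge> N \<Longrightarrow> n \<ge> N \<Longrightarrow> norm (sqrt_majorant m - sqrt_majorant n) < e / (norm x + 1)"
      by (meson CauchyD)
    have "norm (sqrt_iterate K m x - sqrt_iterate K n x) < e" if "m \<ge> N" "n > m" for m n
    proof -
      have "norm (sqrt_iterate K m x - sqrt_iterate K n x) \<le> (sqrt_majorant n - sqrt_majorant m) * norm x"
        using norm_sqrt_iterate_diff_le[OF K, of m n x] that by (simp add: norm_minus_commute)
      also have "\<dots> \<le> (e / (norm x + 1)) * norm x"
        using N[of n m] that by (intro mult_right_mono) auto
      also have "\<dots> < e"
      proof -
        have "norm x + 1 > 0" by (simp add: add_nonneg_pos)
        then show ?thesis using e by (simp add: pos_divide_less_eq distrib_left)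
      qed
      finally show ?thesis .
    qed
    then show "\<exists>M. \<forall>m\<ge>M. \<forall>n>m. dist (sqrt_iterate K m x) (sqrt_iterate K n x) < e"
      unfolding dist_norm by blast
  qed
  then show ?thesis by (simp add: Cauchy_convergent_iff)
qed

lemma sqrt_iterate_self_adjoint:
  assumes "\<And>x y. inner (K x) y = inner x (K y)"
  shows "inner (sqrt_iterate K n x) y = inner x (sqrt_iterate K n y)"
  by (induction n arbitrary: x y) (simp_all add: assms inner_add_left inner_add_right)

lemma sqrt_iterate_commute:
  assumes "linear U" and "\<And>x. U (K x) = K (U x)"
  shows "U (sqrt_iterate K n x) = sqrt_iterate K n (U x)"
  by (induction n arbitrary: x)
    (simp_all add: assms linear_0[OF assms(1)] linear_add[OF assms(1)] linear_scale[OF assms(1)])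

text \<open>
  The root \<open>1 - Y\<close>, with \<open>Y\<close> the limit of the iterates, is positive because \<open>Y\<close> is again a
  contraction. Self-adjointness and commutation pass from the polynomials in \<open>K\<close> to their limit.
\<close>
lemma contraction_complement_sqrt:
  fixes K :: "'h::{real_inner,complete_space} \<Rightarrow> 'h"
  assumes K: "linear K" "\<And>x. norm (K x) \<le> norm x"
    and sa: "\<And>x y. inner (K x) y = inner x (K y)"
  obtains R where "bounded_linear R" "\<And>x. R (R x) = x - K x"
    "\<And>x y. inner (R x) y = inner x (R y)" "\<And>x. 0 \<le> inner (R x) x"
    "\<forall>U. bounded_linear U \<longrightarrow> (\<forall>x. U (K x) = K (U x)) \<longrightarrow> (\<forall>x. U (R x) = R (U x))"
proof -
  let ?Y = "sqrt_iterate K"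
  define Y where "Y x = lim (\<lambda>n. ?Y n x)" for x
  have Y: "(\<lambda>n. ?Y n x) \<longlonglongrightarrow> Y x" for x
    unfolding Y_def using convergent_sqrt_iterate[OF K] by (simp add: convergent_LIMSEQ_iff)
  have le: "norm (?Y n x) \<le> norm x" for n x
    using norm_sqrt_iterate_le[OF K(2), of n x] sqrt_majorant_bounds[of n]
    by (meson mult_left_le_one_le norm_ge_zero order_trans)
  have normY: "norm (Y x) \<le> norm x" for x
    by (rule LIMSEQ_le_const2[OF tendsto_norm[OF Y]]) (use le in blast)
  have addY: "Y (x + y) = Y x + Y y" for x y
  proof (rule LIMSEQ_unique[OF Y])
    show "(\<lambda>n. ?Y n (x + y)) \<longlonglongrightarrow> Y x + Y y"
      using tendsto_add[OF Y Y, of x y] by (simp add: linear_add[OF linear_sqrt_iterate[OF K(1)]])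
  qed
  have scaleY: "Y (r *\<^sub>R x) = r *\<^sub>R Y x" for r x
  proof (rule LIMSEQ_unique[OF Y])
    show "(\<lambda>n. ?Y n (r *\<^sub>R x)) \<longlonglongrightarrow> r *\<^sub>R Y x"
      using tendsto_scaleR[OF tendsto_const Y, of r x]
      by (simp add: linear_scale[OF linear_sqrt_iterate[OF K(1)]])
  qed
  have blY: "bounded_linear Y"
    by (rule bounded_linear_intro[where K=1]) (use addY scaleY normY in auto)
  have YY: "(\<lambda>n. ?Y n (?Y n x)) \<longlonglongrightarrow> Y (Y x)" for x
  proof -
    have "(\<lambda>n. ?Y n (?Y n x - Y x)) \<longlonglongrightarrow> 0"
      by (rule Lim_null_comparison[OF _ tendsto_norm_zero[OF LIM_zero[OF Y[of x]]]])
        (use le in auto)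
    from tendsto_add[OF this Y[of "Y x"]] show ?thesis
      by (simp add: linear_diff[OF linear_sqrt_iterate[OF K(1)]])
  qed
  have fixY: "Y x = (1/2) *\<^sub>R (K x + Y (Y x))" for x
  proof (rule LIMSEQ_unique)
    show "(\<lambda>n. ?Y (Suc n) x) \<longlonglongrightarrow> Y x" by (rule LIMSEQ_Suc[OF Y])
    show "(\<lambda>n. ?Y (Suc n) x) \<longlonglongrightarrow> (1/2) *\<^sub>R (K x + Y (Y x))"
      unfolding sqrt_iterate.simps by (intro tendsto_intros YY)
  qed
  have saY: "inner (Y x) y = inner x (Y y)" for x y
  proof (rule LIMSEQ_unique)
    show "(\<lambda>n. inner (?Y n x) y) \<longlonglongrightarrow> inner (Y x) y" by (intro tendsto_intros Y)
    show "(\<lambda>n. inner (?Y n x) y) \<longlonglongrightarrow> inner x (Y y)"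
      unfolding sqrt_iterate_self_adjoint[of K, OF sa] by (intro tendsto_intros Y)
  qed
  have commY: "U (Y x) = Y (U x)" if U: "bounded_linear U" "\<And>x. U (K x) = K (U x)" for U x
  proof (rule LIMSEQ_unique)
    show "(\<lambda>n. U (?Y n x)) \<longlonglongrightarrow> U (Y x)" by (rule bounded_linear.tendsto[OF U(1) Y])
    show "(\<lambda>n. U (?Y n x)) \<longlonglongrightarrow> Y (U x)"
      unfolding sqrt_iterate_commute[of U K, OF bounded_linear.linear[OF U(1)] U(2)] by (rule Y)
  qed
  show ?thesis
  proof (rule that[of "\<lambda>x. x - Y x"])
    show "bounded_linear (\<lambda>x. x - Y x)" by (intro bounded_linear_intros blY)
    show "(x - Y x) - Y (x - Y x) = x - K x" for x
    proof -
      have "Y x + Y x = K x + Y (Y x)"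
        by (subst (1 2) fixY) (simp add: scaleR_add_left[symmetric])
      then show ?thesis by (simp add: linear_diff[OF bounded_linear.linear[OF blY]] algebra_simps)
    qed
    show "inner (x - Y x) y = inner x (y - Y y)" for x y
      by (simp add: inner_diff_left inner_diff_right saY)
    show "0 \<le> inner (x - Y x) x" for x
    proof -
      have "inner (Y x) x \<le> norm x * norm x"
        by (rule order_trans[OF norm_cauchy_schwarz mult_right_mono[OF normY]]) simp
      then show ?thesis by (simp add: inner_diff_left power2_norm_eq_inner[symmetric] power2_eq_square)
    qed
    show "\<forall>U. bounded_linear U \<longrightarrow> (\<forall>x. U (K x) = K (U x)) \<longrightarrow> (\<forall>x. U (x - Y x) = U x - Y (U x))"
      using commY by (simp add: linear_diff[OF bounded_linear.linear])
  qed
qed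

text \<open>
  A multiple \<open>H\<close> of \<open>G\<close> satisfies \<open>0 \<le> H \<le> 1\<close>. What has to be seen is that \<open>1 - H\<close> is a
  contraction. Expanding \<open>\<langle>H z, z\<rangle> \<ge> 0\<close> at \<open>z = x - H x\<close> gives
  \<open>2 \<parallel>H x\<parallel>\<^sup>2 \<le> \<langle>H x, x\<rangle> + \<langle>H (H x), H x\<rangle>\<close>, whose last term is at most \<open>\<parallel>H x\<parallel>\<^sup>2\<close>; thus
  \<open>\<parallel>H x\<parallel>\<^sup>2 \<le> \<langle>H x, x\<rangle> \<le> 2 \<langle>H x, x\<rangle>\<close>, and the outer inequality says \<open>\<parallel>x - H x\<parallel> \<le> \<parallel>x\<parallel>\<close>.
\<close>
lemma positive_operator_sqrt:
  fixes G :: "'h::{real_inner,complete_space} \<Rightarrow> 'h"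
  assumes G: "bounded_linear G" and sa: "\<And>x y. inner (G x) y = inner x (G y)"
    and pos: "\<And>x. 0 \<le> inner (G x) x"
  obtains R where "bounded_linear R" "\<And>x. R (R x) = G x"
    "\<And>x y. inner (R x) y = inner x (R y)" "\<And>x. 0 \<le> inner (R x) x"
    "\<forall>U. bounded_linear U \<longrightarrow> (\<forall>x. U (G x) = G (U x)) \<longrightarrow> (\<forall>x. U (R x) = R (U x))"
proof -
  interpret G: bounded_linear G by fact
  obtain c where c: "c > 0" "\<And>x. norm (G x) \<le> norm x * c" using G.pos_bounded by blast
  define H where "H x = (1/c) *\<^sub>R G x" for x
  have blH: "bounded_linear H" unfolding H_def by (intro bounded_linear_intros G)
  interpret H: bounded_linear H by (rule blH)
  have normH: "norm (H x) \<le> norm x" for x using c by (simp add: H_def field_simps)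
  have saH: "inner (H x) y = inner x (H y)" for x y by (simp add: H_def sa)
  have posH: "0 \<le> inner (H x) x" for x using c pos by (simp add: H_def)
  have contr: "norm (x - H x) \<le> norm x" for x
  proof -
    have "0 \<le> inner (H (x - H x)) (x - H x)" by (rule posH)
    also have "\<dots> = inner (H x) x - 2 * inner (H x) (H x) + inner (H (H x)) (H x)"
      using saH[of "H x" x] by (simp add: H.diff inner_diff_left inner_diff_right)
    finally have "2 * inner (H x) (H x) \<le> inner (H x) x + inner (H (H x)) (H x)" by simp
    moreover have "inner (H (H x)) (H x) \<le> inner (H x) (H x)"
      using order_trans[OF norm_cauchy_schwarz mult_right_mono[OF normH[of "H x"]]]
      by (simp add: power2_norm_eq_inner[symmetric] power2_eq_square)
    ultimately have "inner (H x) (H x) \<le> 2 * inner (H x) x"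
      using posH[of x] by linarith
    then have "(norm (x - H x))\<^sup>2 \<le> (norm x)\<^sup>2"
      unfolding power2_norm_eq_inner
      by (simp add: inner_diff_left inner_diff_right inner_commute[of x "H x"])
    then show ?thesis by (rule power2_le_imp_le) simp
  qed
  have lin: "linear (\<lambda>x. x - H x)"
    by (intro bounded_linear.linear bounded_linear_intros blH)
  have sa': "inner (x - H x) y = inner x (y - H y)" for x y
    by (simp add: inner_diff_left inner_diff_right saH)
  show ?thesis
  proof (rule contraction_complement_sqrt[OF lin contr sa'])
    fix Q
    assume Q: "bounded_linear Q" "\<And>x. Q (Q x) = x - (x - H x)"
      "\<And>x y. inner (Q x) y = inner x (Q y)" "\<And>x. 0 \<le> inner (Q x) x"
      "\<forall>U. bounded_linear U \<longrightarrow> (\<forall>x. U (x - H x) = U x - H (U x)) \<longrightarrow> (\<forall>x. U (Q x) = Q (U x))"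
    interpret Q: bounded_linear Q by fact
    show ?thesis
    proof (rule that[of "\<lambda>x. sqrt c *\<^sub>R Q x"])
      show "bounded_linear (\<lambda>x. sqrt c *\<^sub>R Q x)" by (intro bounded_linear_intros Q)
      show "sqrt c *\<^sub>R Q (sqrt c *\<^sub>R Q x) = G x" for x
        using c by (simp add: Q.scaleR Q(2) H_def)
      show "inner (sqrt c *\<^sub>R Q x) y = inner x (sqrt c *\<^sub>R Q y)" for x y by (simp add: Q(3))
      show "0 \<le> inner (sqrt c *\<^sub>R Q x) x" for x using c Q(4) by simp
      show "\<forall>U. bounded_linear U \<longrightarrow> (\<forall>x. U (G x) = G (U x))
          \<longrightarrow> (\<forall>x. U (sqrt c *\<^sub>R Q x) = sqrt c *\<^sub>R Q (U x))"
      proof (intro allI impI)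
        fix U x assume U: "bounded_linear U" "\<forall>x. U (G x) = G (U x)"
        interpret U: bounded_linear U by (rule U(1))
        have "\<forall>x. U (x - H x) = U x - H (U x)" by (simp add: U.diff H_def U.scaleR U(2))
        then show "U (sqrt c *\<^sub>R Q x) = sqrt c *\<^sub>R Q (U x)" using Q(5) U(1) by (simp add: U.scaleR)
      qed
    qed
  qed
qed

section \<open>Operators with dense range\<close>

lemma subspace_closure:
  fixes W :: "'a::real_normed_vector set"
  assumes "subspace W"
  shows "subspace (closure W)"
proof (rule subspaceI)
  show "0 \<in> closure W" using subspace_0[OF assms] closure_subset by blast
next
  fix x y assume "x \<in> closure W" "y \<in> closure W"
  then obtain u v where "\<And>n. u n \<in> W" "\<And>n. v n \<in> W" "u \<longlonglongrightarrow> x" "v \<longlonglongrightarrow> y"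
    unfolding closure_sequential by blast
  then show "x + y \<in> closure W"
    unfolding closure_sequential
    by (intro exI[of _ "\<lambda>n. u n + v n"]) (simp add: subspace_add[OF assms] tendsto_add)
next
  fix c x assume "x \<in> closure W"
  then obtain u where "\<And>n. u n \<in> W" "u \<longlonglongrightarrow> x"
    unfolding closure_sequential by blast
  then show "c *\<^sub>R x \<in> closure W"
    unfolding closure_sequential
    by (intro exI[of _ "\<lambda>n. c *\<^sub>R u n"]) (simp add: subspace_scale[OF assms] tendsto_scaleR)
qed

text \<open>
  A vector orthogonal to the range of a self-adjoint operator lies in its kernel.
\<close>
lemma injective_self_adjoint_dense_range:
  fixes A :: "'h::{real_inner,complete_space} \<Rightarrow> 'h"
  assumes A: "bounded_linear A" and sa: "\<And>x y. inner (A x) y = inner x (A y)"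
    and inj: "\<And>x. A x = 0 \<Longrightarrow> x = 0"
  shows "closure (range A) = UNIV"
proof -
  have "y \<in> closure (range A)" for y
  proof -
    have "subspace (range A)"
      by (rule linear_subspace_image[OF bounded_linear.linear[OF A] subspace_UNIV])
    then have "subspace (closure (range A))" by (rule subspace_closure)
    then obtain w where w: "w \<in> closure (range A)" "\<And>v. v \<in> closure (range A) \<Longrightarrow> inner (y - w) v = 0"
      using orthogonal_projection[of "closure (range A)" y] by auto
    have "inner (y - w) (A (A (y - w))) = 0" using w(2) closure_subset by blast
    then have "inner (A (y - w)) (A (y - w)) = 0" by (simp only: sa)
    then have "y = w" using inj[of "y - w"] by simp
    then show ?thesis using w by simp
  qed
  then show ?thesis by blast
qed

lemma eq_on_dense_range:
  fixes f g :: "'a::t2_space \<Rightarrow> 'b::t2_space"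
  assumes "closure (range A) = UNIV" "continuous_on UNIV f" "continuous_on UNIV g"
    and "\<And>x. f (A x) = g (A x)"
  shows "f y = g y"
proof -
  have "closed {y. f y = g y}" by (intro closed_Collect_eq assms)
  moreover have "range A \<subseteq> {y. f y = g y}" using assms by auto
  ultimately have "closure (range A) \<subseteq> {y. f y = g y}" by (simp add: closure_minimal)
  then show ?thesis using assms(1) by blast
qed

text \<open>
  Since \<open>\<parallel>S (x - x')\<parallel> = \<parallel>A (x - x')\<parallel>\<close>, the assignment \<open>A x \<mapsto> S x\<close> is well defined and isometric;
  if \<open>A (u\<^sub>n)\<close> converges, then \<open>S (u\<^sub>n)\<close> is Cauchy, and its limit depends only on the limit of
  \<open>A (u\<^sub>n)\<close>.
\<close>
lemma isometric_extension:
  fixes A :: "'a::real_normed_vector \<Rightarrow> 'b::real_normed_vector"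
    and S :: "'a \<Rightarrow> 'c::{real_normed_vector,complete_space}"
  assumes A: "linear A" and S: "linear S" and dense: "closure (range A) = UNIV"
    and iso: "\<And>x. norm (S x) = norm (A x)"
  obtains V where "bounded_linear V" "\<And>x. V (A x) = S x" "\<And>y. norm (V y) = norm y"
proof -
  have "\<exists>u. (\<lambda>n. A (u n)) \<longlonglongrightarrow> y" for y
  proof -
    have "y \<in> closure (range A)" using dense by simp
    then obtain v where v: "\<And>n. v n \<in> range A" "v \<longlonglongrightarrow> y" unfolding closure_sequential by blast
    then have "\<forall>n. \<exists>x. v n = A x" by blast
    then obtain u where "\<And>n. v n = A (u n)" by metis
    then have "v = (\<lambda>n. A (u n))" by blast
    with v show ?thesis by blast
  qed
  then obtain u where u: "\<And>y. (\<lambda>n. A (u y n)) \<longlonglongrightarrow> y" by metis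
  define V where "V y = lim (\<lambda>n. S (u y n))" for y
  have V0: "(\<lambda>n. S (u y n)) \<longlonglongrightarrow> V y" for y
  proof -
    have "Cauchy (\<lambda>n. A (u y n))" by (rule LIMSEQ_imp_Cauchy[OF u])
    then have "Cauchy (\<lambda>n. S (u y n))"
      by (simp add: Cauchy_iff linear_diff[OF A, symmetric] linear_diff[OF S, symmetric] iso)
    then show ?thesis by (simp add: V_def Cauchy_convergent_iff convergent_LIMSEQ_iff)
  qed
  \<comment> \<open>The value does not depend on the chosen approximating sequence; linearity follows from this.\<close>
  have V: "(\<lambda>n. S (v n)) \<longlonglongrightarrow> V y" if "(\<lambda>n. A (v n)) \<longlonglongrightarrow> y" for v y
  proof -
    have "(\<lambda>n. A (v n) - A (u y n)) \<longlonglongrightarrow> 0" using tendsto_diff[OF that u[of y]] by simp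
    from tendsto_norm_zero[OF this] have "(\<lambda>n. norm (S (v n) - S (u y n))) \<longlonglongrightarrow> 0"
      by (simp only: linear_diff[OF A, symmetric] linear_diff[OF S, symmetric] iso)
    then have "(\<lambda>n. S (v n) - S (u y n)) \<longlonglongrightarrow> 0" by (rule tendsto_norm_zero_cancel)
    from tendsto_add[OF this V0[of y]] show ?thesis by simp
  qed
  have normV: "norm (V y) = norm y" for y
    by (rule LIMSEQ_unique[OF tendsto_norm[OF V0]]) (use tendsto_norm[OF u] iso in simp)
  show ?thesis
  proof (rule that[of V])
    show "bounded_linear V"
    proof (rule bounded_linear_intro[where K=1])
      show "V (x + y) = V x + V y" for x y
        using LIMSEQ_unique[OF V[of "\<lambda>n. u x n + u y n"] , of "x + y" "V x + V y"]
          tendsto_add[OF u u] tendsto_add[OF V0 V0] by (simp add: linear_add A S)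
      show "V (r *\<^sub>R x) = r *\<^sub>R V x" for r x
        using LIMSEQ_unique[OF V[of "\<lambda>n. r *\<^sub>R u x n"] , of "r *\<^sub>R x" "r *\<^sub>R V x"]
          tendsto_scaleR[OF tendsto_const u] tendsto_scaleR[OF tendsto_const V0]
        by (simp add: linear_scale A S)
    qed (simp add: normV)
    show "V (A x) = S x" for x
      using LIMSEQ_unique[OF V[of "\<lambda>n. x" "A x"] tendsto_const] by simp
  qed (rule normV)
qed

text \<open>
  Isometries turn an approximation \<open>v\<^sub>n \<longlonglongrightarrow> y\<close> into one of \<open>s \<mapsto> V\<^sub>s y\<close> that is uniform in \<open>s\<close>, and
  uniform limits of continuous functions are continuous.
\<close>
lemma continuous_isometries_if_dense:
  fixes V :: "'s::topological_space \<Rightarrow> 'a::real_normed_vector \<Rightarrow> 'b::real_normed_vector"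
  assumes lin: "\<And>s. linear (V s)" and iso: "\<And>s y. norm (V s y) = norm y"
    and dense: "closure (range A) = UNIV"
    and cont: "\<And>x. continuous_on UNIV (\<lambda>s. V s (A x))"
  shows "continuous_on UNIV (\<lambda>s. V s y)"
proof -
  have "y \<in> closure (range A)" using dense by simp
  then obtain v where v: "\<And>n. v n \<in> range A" "v \<longlonglongrightarrow> y" unfolding closure_sequential by blast
  show ?thesis
  proof (rule uniform_limit_theorem)
    show "\<forall>\<^sub>F n in sequentially. continuous_on UNIV (\<lambda>s. V s (v n))"
      proof (intro always_eventually allI)
      fix n
      obtain x where "v n = A x" using v(1)[of n] by blast
      then show "continuous_on UNIV (\<lambda>s. V s (v n))" using cont by simp
    qed
    show "uniform_limit UNIV (\<lambda>n s. V s (v n)) (\<lambda>s. V s y) sequentially"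
    proof (rule uniform_limitI)
      fix e :: real assume "e > 0"
      from tendstoD[OF v(2) this]
      show "\<forall>\<^sub>F n in sequentially. \<forall>s\<in>UNIV. dist (V s (v n)) (V s y) < e"
        by (simp add: dist_norm linear_diff[OF lin, symmetric] iso)
    qed
  qed simp
qed

section \<open>Scalars and the real part of the inner product\<close>

context hilbert_space
begin

lemma ip_add_right: "ip z (x + y) = ip z x + ip z y"
  by (metis ip_add_left ip_conjg conjg_add)

lemma ip_scale_right: "ip x (scal c y) = conjg c * ip x y"
  by (metis ip_scale_left ip_conjg conjg_mult)

text \<open>
  Polarization: the real inner product is the real part of \<open>ip\<close>, expressed without a real part.
\<close>
lemma ip_add_ip_commute: "ip x y + ip y x = of_real (2 * inner x y)"
proof -
  have "of_real ((norm (x + y))\<^sup>2) = of_real ((norm x)\<^sup>2) + (ip x y + ip y x) + of_real ((norm y)\<^sup>2)"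
    unfolding ip_self[symmetric] by (simp only: ip_add_left ip_add_right add_ac)
  then have "ip x y + ip y x = of_real ((norm (x + y))\<^sup>2 - (norm x)\<^sup>2 - (norm y)\<^sup>2)"
    unfolding of_real_diff by (simp only: algebra_simps)
  also have "(norm (x + y))\<^sup>2 - (norm x)\<^sup>2 - (norm y)\<^sup>2 = 2 * inner x y"
    unfolding power2_norm_eq_inner by (simp add: inner_add_left inner_add_right inner_commute)
  finally show ?thesis .
qed

lemma inner_scal_left: "inner (scal c x) y = inner x (scal (conjg c) y)"
proof -
  have "(of_real (2 * inner (scal c x) y) :: 'k) = of_real (2 * inner x (scal (conjg c) y))"
    unfolding ip_add_ip_commute[symmetric]
    by (simp only: ip_scale_left ip_scale_right conjg_conjg)
  then show ?thesis unfolding of_real_eq_iff by simp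
qed

lemma norm_scal: "norm (scal c x) = norm c * norm x"
proof -
  have "(of_real ((norm (scal c x))\<^sup>2) :: 'k) = (c * conjg c) * of_real ((norm x)\<^sup>2)"
    unfolding ip_self[symmetric] by (simp only: ip_scale_left ip_scale_right mult_ac)
  also have "\<dots> = of_real ((norm c * norm x)\<^sup>2)"
    by (simp add: mult_conjg power_mult_distrib)
  finally have "(norm (scal c x))\<^sup>2 = (norm c * norm x)\<^sup>2" by (simp only: of_real_eq_iff)
  then show ?thesis by (simp add: power2_eq_iff_nonneg)
qed

lemma bounded_linear_scal: "bounded_linear (scal c)"
proof (rule bounded_linear_intro[where K="norm c"])
  show "scal c (x + y) = scal c x + scal c y" for x y by (rule scale_right_distrib)
  show "scal c (r *\<^sub>R x) = r *\<^sub>R scal c x" for r x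
    by (simp only: scale_of_real[symmetric] scale_scale mult.commute)
  show "norm (scal c x) \<le> norm x * norm c" for x by (simp add: norm_scal mult.commute)
qed

text \<open>
  Symmetry of the real parts suffices. Let \<open>z\<close> be the defect \<open>\<langle>A x, y\<rangle> - \<langle>x, A y\<rangle>\<close>. Replacing \<open>x\<close> by
  \<open>c x\<close> multiplies the defect by \<open>c\<close>, so symmetry of the real parts says that \<open>c z\<close> has vanishing
  real part for every scalar \<open>c\<close>; for \<open>c\<close> the conjugate of \<open>z\<close> this real part is \<open>\<bar>z\<bar>\<^sup>2\<close>.
\<close>
lemma positive_operatorI:
  assumes A: "A \<in> bounded_operators scal"
    and sa: "\<And>x y. inner (blinfun_apply A x) y = inner x (blinfun_apply A y)"
    and pos: "\<And>x. 0 \<le> inner (blinfun_apply A x) x"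
  shows "positive_operator ip A"
proof -
  have ip_sa: "ip (blinfun_apply A x) y = ip x (blinfun_apply A y)" for x y
  proof -
    define z where "z = ip (blinfun_apply A x) y - ip x (blinfun_apply A y)"
    have cnj_diff: "conjg (a - b) = conjg a - conjg b" for a b :: 'k
      using conjg_add[of "a - b" b] by simp
    define u where "u = scal (conjg z) x"
    have Au: "blinfun_apply A u = scal (conjg z) (blinfun_apply A x)"
      using A by (simp add: bounded_operators_def u_def)
    have "conjg z * z + conjg (conjg z * z)
        = (ip (blinfun_apply A u) y + ip y (blinfun_apply A u))
          - (ip u (blinfun_apply A y) + ip (blinfun_apply A y) u)"
    proof -
      have z: "conjg z * z = ip (blinfun_apply A u) y - ip u (blinfun_apply A y)"
        unfolding Au by (simp add: u_def z_def ip_scale_left algebra_simps)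
      show ?thesis
        unfolding z cnj_diff ip_conjg[symmetric] by (simp add: algebra_simps)
    qed
    also have "\<dots> = 0" unfolding ip_add_ip_commute by (simp add: sa)
    finally have "conjg z * z + conjg (conjg z * z) = 0" .
    moreover have "conjg z * z = of_real ((norm z)\<^sup>2)" using mult_conjg[of z] by (simp only: mult.commute)
    ultimately have "of_real (2 * (norm z)\<^sup>2) = (0 :: 'k)" by (simp only: conjg_of_real) simp
    then have "z = 0" by simp
    then show ?thesis by (simp add: z_def)
  qed
  have "ip (blinfun_apply A x) x = of_real (inner (blinfun_apply A x) x)" for x
    using ip_add_ip_commute[of "blinfun_apply A x" x] ip_sa[of x x] by simp
  with ip_sa pos show ?thesis by (auto simp: positive_operator_def)
qed

end

section \<open>Averaging the inner product along orbits\<close>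

lemma mean_abs_le_norm:
  assumes "right_invariant_mean \<phi>" and "f \<in> C_norm"
  shows "\<bar>\<phi> f\<bar> \<le> norm f"
proof -
  have "apply_bcontfun f s \<le> norm f" "- norm f \<le> apply_bcontfun f s" for s
    using norm_bounded[of f s] by (auto simp: abs_le_iff)
  then have "Sup (range (apply_bcontfun f)) \<le> norm f" "- norm f \<le> Inf (range (apply_bcontfun f))"
    by (auto intro!: cSUP_least cINF_greatest)
  then show ?thesis using assms by (fastforce simp: right_invariant_mean_def)
qed

text \<open>
  The functions to be averaged. Their values are as displayed when the orbits \<open>s \<mapsto> S\<^sub>s x\<close> are
  continuous and the operators \<open>S\<^sub>s\<close> are bounded uniformly in \<open>s\<close>, so that the argument of
  \<open>Bcontfun\<close> is a bounded continuous function.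
\<close>
definition orbit_form ::
    "('s::topological_space \<Rightarrow> 'h \<Rightarrow> 'g::real_inner) \<Rightarrow> 'h \<Rightarrow> 'h \<Rightarrow> ('s \<Rightarrow>\<^sub>C real)" where
  "orbit_form S x y = Bcontfun (\<lambda>s. inner (S s x) (S s y))"

lemma apply_orbit_form:
  assumes cont: "\<And>x. continuous_on UNIV (\<lambda>s. S s x)"
    and bd: "\<And>s x. norm (S s x) \<le> C * norm x"
  shows "apply_bcontfun (orbit_form S x y) s = inner (S s x) (S s y)"
proof -
  have "norm (inner (S s x) (S s y)) \<le> (C * norm x) * (C * norm y)" for s
  proof -
    have "norm (inner (S s x) (S s y)) \<le> norm (S s x) * norm (S s y)"
      using Cauchy_Schwarz_ineq2 by simp
    also have "\<dots> \<le> (C * norm x) * (C * norm y)"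
      by (rule mult_mono'[OF bd bd]) auto
    finally show ?thesis .
  qed
  then have "(\<lambda>s. inner (S s x) (S s y)) \<in> bcontfun"
    by (intro bcontfun_normI continuous_on_inner cont)
  then show ?thesis by (simp add: orbit_form_def Bcontfun_inverse)
qed

lemma bounded_bilinear_orbit_form:
  assumes lin: "\<And>s. linear (S s)"
    and cont: "\<And>x. continuous_on UNIV (\<lambda>s. S s x)"
    and bd: "\<And>s x. norm (S s x) \<le> C * norm x"
  shows "bounded_bilinear (orbit_form S)"
proof
  note app = apply_orbit_form[of S, OF cont bd]
  show "orbit_form S (a + a') b = orbit_form S a b + orbit_form S a' b" for a a' b
    by (rule bcontfun_eqI) (simp add: app linear_add[OF lin] inner_add_left)
  show "orbit_form S a (b + b') = orbit_form S a b + orbit_form S a b'" for a b b'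
    by (rule bcontfun_eqI) (simp add: app linear_add[OF lin] inner_add_right)
  show "orbit_form S (r *\<^sub>R a) b = r *\<^sub>R orbit_form S a b" for r a b
    by (rule bcontfun_eqI) (simp add: app linear_scale[OF lin])
  show "orbit_form S a (r *\<^sub>R b) = r *\<^sub>R orbit_form S a b" for r a b
    by (rule bcontfun_eqI) (simp add: app linear_scale[OF lin])
  show "\<exists>K. \<forall>a b. norm (orbit_form S a b) \<le> norm a * norm b * K"
  proof (intro exI allI)
    fix a b
    show "norm (orbit_form S a b) \<le> norm a * norm b * (C * C)"
    proof (rule norm_bound)
      fix s
      have "norm (inner (S s a) (S s b)) \<le> norm (S s a) * norm (S s b)"
        using Cauchy_Schwarz_ineq2 by simp
      also have "\<dots> \<le> (C * norm a) * (C * norm b)"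
        by (rule mult_mono'[OF bd bd]) auto
      finally show "norm (apply_bcontfun (orbit_form S a b) s) \<le> norm a * norm b * (C * C)"
        by (simp add: app mult_ac)
    qed
  qed
qed

text \<open>
  Here \<open>S\<close> stands for \<open>A\<^sub>0 T\<close>. Translating the function amounts to moving the two vectors along
  the orbit, which is how invariance of a mean becomes invariance of the averaged form.
\<close>
lemma right_translate_orbit_form:
  fixes S :: "'s::{semigroup_mult,topological_space} \<Rightarrow> 'h::real_normed_vector \<Rightarrow> 'g::real_inner"
  assumes cont: "\<And>x. continuous_on UNIV (\<lambda>s. S s x)"
    and bd: "\<And>s x. norm (S s x) \<le> C * norm x"
    and hom: "\<And>t s x. S (t * s) x = S t (T s x)"
  shows "right_translate s (orbit_form S x y) = orbit_form S (T s x) (T s y)"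
  unfolding right_translate_def apply_orbit_form[of S, OF cont bd] hom
  by (simp only: orbit_form_def)

text \<open>
  The translates of an orbit form are orbit forms at moved vectors, so their norm continuity
  reduces to the continuity of a bounded bilinear map along the strongly continuous orbits.
\<close>
lemma orbit_form_in_C_norm:
  fixes S :: "'s::{semigroup_mult,topological_space} \<Rightarrow> 'h::real_normed_vector \<Rightarrow> 'g::real_inner"
  assumes lin: "\<And>s. linear (S s)"
    and cont: "\<And>x. continuous_on UNIV (\<lambda>s. S s x)"
    and bd: "\<And>s x. norm (S s x) \<le> C * norm x"
    and hom: "\<And>t s x. S (t * s) x = S t (T s x)"
    and T_cont: "\<And>x. continuous_on UNIV (\<lambda>s. T s x)"
    and T_hom: "\<And>s t x. T (s * t) x = T s (T t x)"
  shows "orbit_form S x y \<in> C_norm"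
proof -
  note app = apply_orbit_form[of S, OF cont bd]
  note tr = right_translate_orbit_form[of S C T, OF cont bd hom]
  have *: "continuous_on UNIV (\<lambda>s. orbit_form S (T s x) (T s y))" for x y
    by (intro bounded_bilinear.continuous_on[OF bounded_bilinear_orbit_form[OF lin cont bd]] T_cont)
  have "orbit_form S x y \<in> C_r"
    unfolding C_r_def by (auto simp: app hom intro!: continuous_on_inner cont)
  then show ?thesis unfolding C_norm_def by (auto simp: tr T_hom *)
qed

text \<open>
  The form is the mean of the orbit forms. The last property lets any identity between the
  integrands pass to the form; it is used to move scalars from one argument to the other.
\<close>
lemma averaged_form:
  fixes T :: "'s::{semigroup_mult,topological_space} \<Rightarrow> 'h \<Rightarrow> 'h::real_normed_vector"
    and S :: "'s \<Rightarrow> 'h \<Rightarrow> 'g::real_inner"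
  assumes amen: "weakly_right_amenable TYPE('s)"
    and lin: "\<And>s. linear (S s)"
    and cont: "\<And>x. continuous_on UNIV (\<lambda>s. S s x)"
    and bd: "\<And>s x. norm (S s x) \<le> C * norm x"
    and hom: "\<And>t s x. S (t * s) x = S t (T s x)"
    and T_cont: "\<And>x. continuous_on UNIV (\<lambda>s. T s x)"
    and T_hom: "\<And>s t x. T (s * t) x = T s (T t x)"
  obtains B where "bounded_bilinear B" "\<And>x y. B x y = B y x" "\<And>s x y. B (T s x) (T s y) = B x y"
    "\<And>x a. (\<And>s. a \<le> (norm (S s x))\<^sup>2) \<Longrightarrow> a \<le> B x x"
    "\<And>x a. (\<And>s. (norm (S s x))\<^sup>2 \<le> a) \<Longrightarrow> B x x \<le> a"
    "\<And>x y x' y'. (\<And>s. inner (S s x) (S s y) = inner (S s x') (S s y')) \<Longrightarrow> B x y = B x' y'"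
proof -
  obtain \<phi> :: "('s \<Rightarrow>\<^sub>C real) \<Rightarrow> real" where \<phi>: "right_invariant_mean \<phi>"
    using amen unfolding weakly_right_amenable_def by blast
  let ?F = "orbit_form S"
  interpret F: bounded_bilinear ?F by (rule bounded_bilinear_orbit_form[OF lin cont bd])
  have F: "?F x y \<in> C_norm" for x y
    by (rule orbit_form_in_C_norm[OF lin cont bd hom T_cont T_hom])
  note app = apply_orbit_form[of S, OF cont bd]
  have add: "\<phi> (f + g) = \<phi> f + \<phi> g" and scale: "\<phi> (c *\<^sub>R f) = c * \<phi> f"
    if "f \<in> C_norm" "g \<in> C_norm" for f g c
    using \<phi> that by (auto simp: right_invariant_mean_def)
  have bounds: "Inf (range (apply_bcontfun (?F x y))) \<le> \<phi> (?F x y)"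
    "\<phi> (?F x y) \<le> Sup (range (apply_bcontfun (?F x y)))" for x y
    using \<phi> F by (auto simp: right_invariant_mean_def)
  obtain K where K: "\<And>x y. norm (?F x y) \<le> norm x * norm y * K" using F.bounded by blast
  show ?thesis
  proof (rule that[of "\<lambda>x y. \<phi> (?F x y)"])
    show "bounded_bilinear (\<lambda>x y. \<phi> (?F x y))"
    proof
      show "\<exists>K. \<forall>a b. norm (\<phi> (?F a b)) \<le> norm a * norm b * K"
        using order_trans[OF mean_abs_le_norm[OF \<phi> F] K] by auto
    qed (simp_all add: F.add_left F.add_right F.scaleR_left F.scaleR_right add[OF F F] scale[OF F F])
    show "\<phi> (?F x y) = \<phi> (?F y x)" for x y
      by (simp add: orbit_form_def inner_commute)
    show "\<phi> (?F (T s x) (T s y)) = \<phi> (?F x y)" for s x y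
    proof -
      have "\<phi> (right_translate s (?F x y)) = \<phi> (?F x y)"
        using \<phi> F by (auto simp: right_invariant_mean_def)
      then show ?thesis by (simp add: right_translate_orbit_form[of S C T, OF cont bd hom])
    qed
    show "a \<le> \<phi> (?F x x)" if "\<And>s. a \<le> (norm (S s x))\<^sup>2" for a x
      by (rule order_trans[OF _ bounds(1)], rule cINF_greatest)
        (use that in \<open>auto simp: app power2_norm_eq_inner\<close>)
    show "\<phi> (?F x x) \<le> a" if "\<And>s. (norm (S s x))\<^sup>2 \<le> a" for a x
      by (rule order_trans[OF bounds(2)], rule cSUP_least)
        (use that in \<open>auto simp: app power2_norm_eq_inner\<close>)
    show "\<phi> (?F x y) = \<phi> (?F x' y')"
      if "\<And>s. inner (S s x) (S s y) = inner (S s x') (S s y')" for x y x' y'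
      by (simp add: orbit_form_def that)
  qed
qed

section \<open>Similarity to a representation by isometries\<close>

theorem proposition4p16:
  fixes scal :: "'k::real_or_complex_field \<Rightarrow> 'h::{real_inner,complete_space} \<Rightarrow> 'h"
    and ip :: "'h \<Rightarrow> 'h \<Rightarrow> 'k"
    and T :: "'s::{semigroup_mult,topological_space} \<Rightarrow> ('h \<Rightarrow>\<^sub>L 'h)"
    and A0 :: "'h \<Rightarrow>\<^sub>L 'h"
    and m M :: "'h \<Rightarrow> real"
  assumes "hilbert_space scal ip"
    and "weakly_right_amenable TYPE('s)"
    and "sot_continuous_hom scal T"
    and "A0 \<in> bounded_operators scal"
    and "\<And>x. m x > 0" and "\<And>x. M x > 0"
    and "\<And>x s. m x * norm x \<le> norm (blinfun_apply A0 (blinfun_apply (T s) x))"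
    and "\<And>x s. norm (blinfun_apply A0 (blinfun_apply (T s) x)) \<le> M x * norm x"
  shows "\<exists>A \<in> bounded_operators scal. \<exists>V :: 's \<Rightarrow> ('h \<Rightarrow>\<^sub>L 'h).
           positive_operator ip A \<and> {x. blinfun_apply A x = 0} = {0} \<and>
           sot_continuous_hom scal V \<and>
           (\<forall>x. m x * norm x \<le> norm (blinfun_apply A x) \<and> norm (blinfun_apply A x) \<le> M x * norm x) \<and>
           (\<forall>s. A o\<^sub>L T s = V s o\<^sub>L A) \<and>
           (\<forall>s x. norm (blinfun_apply (V s) x) = norm x)"
proof -
  interpret hilbert_space scal ip by fact
  note m_pos = assms(5) and lower = assms(7) and upper = assms(8)
  have T_scal: "blinfun_apply (T s) (scal c x) = scal c (blinfun_apply (T s) x)" for s c x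
    using assms(3) by (auto simp: sot_continuous_hom_def bounded_operators_def)
  have T_hom: "blinfun_apply (T (s * t)) x = blinfun_apply (T s) (blinfun_apply (T t) x)" for s t x
    using assms(3) by (auto simp: sot_continuous_hom_def)
  have T_cont: "continuous_on UNIV (\<lambda>s. blinfun_apply (T s) x)" for x
    using assms(3) by (simp add: sot_continuous_hom_def continuous_on_strong_operator_topo_iff_coordinatewise)
  define S where "S s x = blinfun_apply A0 (blinfun_apply (T s) x)" for s x
  have blS: "bounded_linear (S s)" for s unfolding S_def by (intro bounded_linear_intros)
  have S_scal: "S s (scal c x) = scal c (S s x)" for s c x
    using assms(4) by (simp add: S_def T_scal bounded_operators_def)
  have S_cont: "continuous_on UNIV (\<lambda>s. S s x)" for x
    unfolding S_def by (intro continuous_intros T_cont)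
  obtain C where C: "\<And>s x. norm (S s x) \<le> C * norm x"
    using uniform_boundedness[of S, OF blS] upper unfolding S_def by blast
  have S_hom: "S (t * s) x = S t (blinfun_apply (T s) x)" for t s x by (simp add: S_def T_hom)
  obtain B where B: "bounded_bilinear B" "\<And>x y. B x y = B y x"
    "\<And>s x y. B (blinfun_apply (T s) x) (blinfun_apply (T s) y) = B x y"
    and B_lower: "\<And>x a. (\<And>s. a \<le> (norm (S s x))\<^sup>2) \<Longrightarrow> a \<le> B x x"
    and B_upper: "\<And>x a. (\<And>s. (norm (S s x))\<^sup>2 \<le> a) \<Longrightarrow> B x x \<le> a"
    and B_cong: "\<And>x y x' y'. (\<And>s. inner (S s x) (S s y) = inner (S s x') (S s y')) \<Longrightarrow> B x y = B x' y'"
    by (rule averaged_form[where S=S and T="\<lambda>s. blinfun_apply (T s)" and C=C, OF assms(2)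
          bounded_linear.linear[OF blS] S_cont C S_hom T_cont T_hom]) blast
  obtain G where G: "bounded_linear G" "\<And>x y. inner (G x) y = B x y"
    using bounded_form_operator[OF B(1)] by blast
  have G_sa: "inner (G x) y = inner x (G y)" for x y
    using B(2) by (simp add: G(2) inner_commute[of x "G y"])
  have G_pos: "0 \<le> inner (G x) x" for x unfolding G(2) by (rule B_lower) simp
  have G_scal: "G (scal c x) = scal c (G x)" for c x
  proof (rule vector_eq_rdot[THEN iffD1], rule allI)
    fix y
    have "B (scal c x) y = B x (scal (conjg c) y)"
      by (rule B_cong) (simp add: S_scal inner_scal_left)
    then show "inner (G (scal c x)) y = inner (scal c (G x)) y"
      by (simp add: G(2) inner_scal_left)
  qed
  obtain R where R: "bounded_linear R" "\<And>x. R (R x) = G x"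
    "\<And>x y. inner (R x) y = inner x (R y)" "\<And>x. 0 \<le> inner (R x) x"
    and R_comm: "\<forall>U. bounded_linear U \<longrightarrow> (\<forall>x. U (G x) = G (U x)) \<longrightarrow> (\<forall>x. U (R x) = R (U x))"
    by (rule positive_operator_sqrt[OF G(1) G_sa G_pos]) blast
  have R_scal: "R (scal c x) = scal c (R x)" for c x
    using R_comm[rule_format, OF bounded_linear_scal] G_scal by metis
  have norm_R: "(norm (R x))\<^sup>2 = B x x" for x
    using R(3)[of "R x" x] by (simp add: power2_norm_eq_inner R(2) G(2))
  have R_lower: "m x * norm x \<le> norm (R x)" for x
  proof (rule power2_le_imp_le)
    show "(m x * norm x)\<^sup>2 \<le> (norm (R x))\<^sup>2"
      unfolding norm_R using lower m_pos[of x]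
      by (intro B_lower power_mono) (auto simp: S_def)
  qed simp
  have R_upper: "norm (R x) \<le> M x * norm x" for x
  proof (rule power2_le_imp_le)
    show "(norm (R x))\<^sup>2 \<le> (M x * norm x)\<^sup>2"
      unfolding norm_R using upper by (intro B_upper power_mono) (auto simp: S_def)
    show "0 \<le> M x * norm x" using assms(6)[of x] by simp
  qed
  have R_inj: "x = 0" if "R x = 0" for x
    using R_lower[of x] m_pos[of x] that by (simp add: mult_le_0_iff)
  have dense: "closure (range R) = UNIV"
    by (rule injective_self_adjoint_dense_range[OF R(1,3) R_inj])
  have "\<exists>V. bounded_linear V \<and> (\<forall>x. V (R x) = R (blinfun_apply (T s) x)) \<and> (\<forall>y. norm (V y) = norm y)" for s
  proof (rule isometric_extension[where A=R and S="\<lambda>x. R (blinfun_apply (T s) x)"])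
    show "linear R" "linear (\<lambda>x. R (blinfun_apply (T s) x))"
      by (intro bounded_linear.linear bounded_linear_compose[OF R(1)] R(1) blinfun.bounded_linear_right)+
    show "closure (range R) = UNIV" by (rule dense)
    show "norm (R (blinfun_apply (T s) x)) = norm (R x)" for x
      by (rule power2_eq_imp_eq) (simp_all add: norm_R B(3))
  qed blast
  then obtain W where W: "\<And>s. bounded_linear (W s)" "\<And>s x. W s (R x) = R (blinfun_apply (T s) x)"
    "\<And>s y. norm (W s y) = norm y" by metis
  note W_cont = bounded_linear.continuous_on[OF W(1)]
  have W_scal: "W s (scal c y) = scal c (W s y)" for s c y
    by (rule eq_on_dense_range[OF dense])
      (auto intro!: W_cont bounded_linear.continuous_on[OF bounded_linear_scal] continuous_on_id
        simp: R_scal[symmetric] W(2) T_scal)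
  have W_hom: "W (s * t) y = W s (W t y)" for s t y
    by (rule eq_on_dense_range[OF dense]) (auto intro!: W_cont continuous_on_id simp: W(2) T_hom)
  have W_sot: "continuous_on UNIV (\<lambda>s. W s y)" for y
  proof (rule continuous_isometries_if_dense[OF bounded_linear.linear[OF W(1)] W(3) dense])
    show "continuous_on UNIV (\<lambda>s. W s (R x))" for x
      unfolding W(2) by (rule bounded_linear.continuous_on[OF R(1) T_cont])
  qed
  define A where "A = Blinfun R"
  define V where "V s = Blinfun (W s)" for s
  have A: "blinfun_apply A = R" unfolding A_def by (rule bounded_linear_Blinfun_apply[OF R(1)])
  have V: "blinfun_apply (V s) = W s" for s unfolding V_def by (rule bounded_linear_Blinfun_apply[OF W(1)])
  have A_ops: "A \<in> bounded_operators scal" by (simp add: bounded_operators_def A R_scal)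
  show ?thesis
  proof (intro bexI[of _ A] exI[of _ V] conjI allI A_ops)
    show "positive_operator ip A" by (rule positive_operatorI[OF A_ops]) (simp add: A R(3), simp add: A R(4))
    show "{x. blinfun_apply A x = 0} = {0}"
      using R_inj bounded_linear.linear[OF R(1), THEN linear_0] by (auto simp: A)
    show "sot_continuous_hom scal V"
      unfolding sot_continuous_hom_def continuous_on_strong_operator_topo_iff_coordinatewise
      by (auto simp: bounded_operators_def V W_scal W_hom W_sot intro!: blinfun_eqI)
    show "m x * norm x \<le> norm (blinfun_apply A x)" "norm (blinfun_apply A x) \<le> M x * norm x" for x
      by (simp_all add: A R_lower R_upper)
    show "A o\<^sub>L T s = V s o\<^sub>L A" for s by (rule blinfun_eqI) (simp add: A V W(2))
    show "norm (blinfun_apply (V s) x) = norm x" for s x by (simp add: V W(3))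
  qed
qed

end
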